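(* Let $F$ be a field, let $D$ be a division algebra with center $F$ and degree $d>2$, let $K|F$ be any splitting field of $D$, and regard $D$ as an $F$-subalgebra of $M_d(K)$ via a splitting representation. Suppose $d$ is not a power of $2$. Then for any $z\in\mathrm{SL}_1(D)$ and $g\in\mathrm{GL}_d(K)$, the matrix $gzg^{-1}$ cannot be of the form $$A=\begin{pmatrix} 0 & a_1 & 0 & \cdots & 0\\ 0 & 0 & a_2 & \cdots & 0\\ \vdots & \vdots & \ddots & \ddots & \vdots\\ 0 & 0 & 0 & \ddots & a_{d-1}\\ a_d & 0 & 0 & \cdots & 0\end{pmatrix}$$ with $a_1,\dots,a_d\in K$ (i.e. the matrix with entry $a_i$ in position $(i,i+1)$ for $1\le i\le d-1$, entry $a_d$ in position $(d,1)$, and all other entries zero).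
   Context: A division algebra $D$ with center $F$ has degree $d$ if $\dim_F(D)=d^2$. A splitting field of $D$ is a field extension $K|F$ with $D\otimes_F K\cong M_d(K)$; a splitting representation is the resulting injective $F$-algebra homomorphism $D\hookrightarrow D\otimes_F K\cong M_d(K)$. $\mathrm{SL}_1(D)$ is the group of elements of $D$ of reduced norm $1$, i.e. those whose image in $M_d(K)$ has determinant $1$. *)

theory Defs
  imports
    "HOL-Algebra.QuotRing"
    "HOL-Library.Poly_Mapping"
    "Jordan_Normal_Form.Matrix"
    "Jordan_Normal_Form.Determinant"
begin

text \<open>
  An algebra over the field \<open>'f\<close> is given by its structure map; \<open>\<iota> f * x\<close> is the scalar
  multiple of \<open>x\<close> by \<open>f\<close>. That the range is the whole centre says that the centre
  of the division algebra is exactly the (isomorphic image of the) base field.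
\<close>

definition central_division_algebra :: "('f::field \<Rightarrow> 'd::division_ring) \<Rightarrow> bool" where
  "central_division_algebra \<iota> \<longleftrightarrow>
     Ring_Hom.ring_hom \<iota> \<and> range \<iota> = {x. \<forall>y. x * y = y * x}"

text \<open>
  The library dimension of an infinite-dimensional space is \<open>0\<close>, so \<open>0 < d\<close> makes the
  algebra finite-dimensional.
\<close>

definition has_degree :: "('f::field \<Rightarrow> 'd::division_ring) \<Rightarrow> nat \<Rightarrow> bool" where
  "has_degree \<iota> d \<longleftrightarrow> 0 < d \<and> vector_space.dim (\<lambda>f x. \<iota> f * x) (UNIV :: 'd set) = d\<^sup>2"

definition field_extension :: "('f::field \<Rightarrow> 'k::field) \<Rightarrow> bool" where
  "field_extension \<kappa> \<longleftrightarrow> Ring_Hom.ring_hom \<kappa>"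

text \<open>
  The tensor product of \<open>'d\<close> and \<open>'k\<close> over \<open>'f\<close> is the free abelian group on \<open>'d \<times> 'k\<close>,
  with multiplication extended biadditively from \<open>(x, c) (y, e) = (x y, c e)\<close>,
  modulo the ideal generated by the bilinearity relations. (The additive subgroup
  generated by these relations already is an ideal, because the image of the base field
  is central.)
\<close>

definition pair_mult ::
  "('d::ring_1 \<times> 'k::ring_1 \<Rightarrow>\<^sub>0 int) \<Rightarrow> ('d \<times> 'k \<Rightarrow>\<^sub>0 int) \<Rightarrow> ('d \<times> 'k \<Rightarrow>\<^sub>0 int)" where
  "pair_mult a b =
     frag_extend (\<lambda>(x, c). frag_extend (\<lambda>(y, e). frag_of (x * y, c * e)) b) a"

definition pair_ring :: "('d::ring_1 \<times> 'k::ring_1 \<Rightarrow>\<^sub>0 int) ring" where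
  "pair_ring = \<lparr>carrier = UNIV, monoid.mult = pair_mult, one = frag_of (1, 1),
                zero = 0, add = (+)\<rparr>"

definition tensor_relations ::
  "('f \<Rightarrow> 'd::ring_1) \<Rightarrow> ('f \<Rightarrow> 'k::ring_1) \<Rightarrow> ('d \<times> 'k \<Rightarrow>\<^sub>0 int) set" where
  "tensor_relations \<iota> \<kappa> =
     {frag_of (x + y, c) - frag_of (x, c) - frag_of (y, c) | x y c. True} \<union>
     {frag_of (x, c + e) - frag_of (x, c) - frag_of (x, e) | x c e. True} \<union>
     {frag_of (\<iota> f * x, c) - frag_of (x, \<kappa> f * c) | f x c. True}"

definition tensor_ideal ::
  "('f \<Rightarrow> 'd::ring_1) \<Rightarrow> ('f \<Rightarrow> 'k::ring_1) \<Rightarrow> ('d \<times> 'k \<Rightarrow>\<^sub>0 int) set" where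
  "tensor_ideal \<iota> \<kappa> = genideal pair_ring (tensor_relations \<iota> \<kappa>)"

definition tensor_product ::
  "('f \<Rightarrow> 'd::ring_1) \<Rightarrow> ('f \<Rightarrow> 'k::ring_1) \<Rightarrow> ('d \<times> 'k \<Rightarrow>\<^sub>0 int) set ring" where
  "tensor_product \<iota> \<kappa> = pair_ring Quot (tensor_ideal \<iota> \<kappa>)"

definition pure_tensor ::
  "('f \<Rightarrow> 'd::ring_1) \<Rightarrow> ('f \<Rightarrow> 'k::ring_1) \<Rightarrow> 'd \<Rightarrow> 'k \<Rightarrow> ('d \<times> 'k \<Rightarrow>\<^sub>0 int) set" where
  "pure_tensor \<iota> \<kappa> x c = tensor_ideal \<iota> \<kappa> +>\<^bsub>pair_ring\<^esub> frag_of (x, c)"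

lemma pair_mult_of [simp]:
  "pair_mult (frag_of (x, c)) (frag_of (y, e)) = frag_of (x * y, c * e)"
  by (simp add: pair_mult_def)

lemma frag_induct [case_names zero one diff]:
  assumes "P 0" "\<And>p. P (frag_of p)" "\<And>a b. P a \<Longrightarrow> P b \<Longrightarrow> P (a - b)"
  shows "P a"
  using frag_induction[of a UNIV P] assms by blast

lemma pair_mult_zero_left [simp]: "pair_mult 0 b = 0"
  by (simp add: pair_mult_def)

lemma pair_mult_diff_left: "pair_mult (a - a') b = pair_mult a b - pair_mult a' b"
  by (simp add: pair_mult_def frag_extend_diff)

lemma pair_mult_add_left: "pair_mult (a + a') b = pair_mult a b + pair_mult a' b"
  by (simp add: pair_mult_def frag_extend_add)

lemma pair_mult_zero_right [simp]: "pair_mult a 0 = 0"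
  by (simp add: pair_mult_def frag_extend_eq_0 split_def)

lemma pair_mult_diff_right: "pair_mult a (b - b') = pair_mult a b - pair_mult a b'"
proof (induction a rule: frag_induct)
  case (diff a a') then show ?case by (simp add: pair_mult_diff_left)
qed (auto simp: pair_mult_def frag_extend_diff split: prod.split)

lemma pair_mult_add_right: "pair_mult a (b + b') = pair_mult a b + pair_mult a b'"
  using pair_mult_diff_right[of a "b + b'" b'] by simp

lemma pair_mult_assoc: "pair_mult (pair_mult a b) c = pair_mult a (pair_mult b c)"
proof (induction a rule: frag_induct)
  case (one p)
  show ?case
  proof (induction b rule: frag_induct)
    case (one q)
    show ?case
    proof (induction c rule: frag_induct)
      case (one r)
      then show ?case by (cases p; cases q; cases r) (simp add: mult.assoc)
    qed (simp_all add: pair_mult_diff_right)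
  qed (simp_all add: pair_mult_diff_left pair_mult_diff_right)
qed (simp_all add: pair_mult_diff_left)

lemma pair_mult_one_left [simp]: "pair_mult (frag_of (1, 1)) a = a"
  by (induction a rule: frag_induct) (auto simp: pair_mult_diff_right)

lemma pair_mult_one_right [simp]: "pair_mult a (frag_of (1, 1)) = a"
  by (induction a rule: frag_induct) (auto simp: pair_mult_diff_left)

lemma ring_pair_ring: "ring pair_ring"
proof (rule ringI)
  show "abelian_group pair_ring"
    by (rule abelian_groupI)
      (auto simp: pair_ring_def add.assoc add.commute intro: exI[of _ "- x" for x])
  show "monoid pair_ring"
    by (rule monoidI) (auto simp: pair_ring_def pair_mult_assoc)
qed (auto simp: pair_ring_def pair_mult_add_left pair_mult_add_right)

lemma ideal_tensor_ideal: "ideal (tensor_ideal \<iota> \<kappa>) pair_ring"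
  unfolding tensor_ideal_def
  by (rule ring.genideal_ideal[OF ring_pair_ring]) (simp add: pair_ring_def)

lemma ring_tensor_product: "ring (tensor_product \<iota> \<kappa>)"
  unfolding tensor_product_def by (rule ideal.quotient_is_ring[OF ideal_tensor_ideal])

lemma pure_tensor_mult:
  "pure_tensor \<iota> \<kappa> x c \<otimes>\<^bsub>tensor_product \<iota> \<kappa>\<^esub> pure_tensor \<iota> \<kappa> y e
     = pure_tensor \<iota> \<kappa> (x * y) (c * e)"
proof -
  interpret ideal "tensor_ideal \<iota> \<kappa>" pair_ring by (rule ideal_tensor_ideal)
  show ?thesis
    using rcoset_mult_add[of "frag_of (x, c)" "frag_of (y, e)"]
    by (simp add: tensor_product_def pure_tensor_def FactRing_def pair_ring_def)
qed

lemma one_tensor_product: "\<one>\<^bsub>tensor_product \<iota> \<kappa>\<^esub> = pure_tensor \<iota> \<kappa> 1 1"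
  by (simp add: tensor_product_def pure_tensor_def FactRing_def pair_ring_def)

lemma minus_pair_ring: "a \<ominus>\<^bsub>pair_ring\<^esub> b = a - b"
proof -
  interpret ring pair_ring by (rule ring_pair_ring)
  have "\<ominus>\<^bsub>pair_ring\<^esub> b = - b"
    by (rule minus_equality) (simp_all add: pair_ring_def)
  then show ?thesis by (simp add: a_minus_def) (simp add: pair_ring_def)
qed

lemma tensor_coset_eq:
  assumes "a - b \<in> tensor_relations \<iota> \<kappa>"
  shows "tensor_ideal \<iota> \<kappa> +>\<^bsub>pair_ring\<^esub> a = tensor_ideal \<iota> \<kappa> +>\<^bsub>pair_ring\<^esub> b"
proof -
  interpret ring pair_ring by (rule ring_pair_ring)
  have UNIV: "carrier pair_ring = UNIV" by (simp add: pair_ring_def)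
  have "a - b \<in> tensor_ideal \<iota> \<kappa>"
    unfolding tensor_ideal_def using genideal_self[of "tensor_relations \<iota> \<kappa>"] assms
    by (auto simp: UNIV)
  then show ?thesis
    using quotient_eq_iff_same_a_r_cos[OF ideal_tensor_ideal, of a b \<iota> \<kappa>]
    by (simp add: minus_pair_ring UNIV)
qed

lemma pure_tensor_add_left:
  "pure_tensor \<iota> \<kappa> (x + y) c
     = pure_tensor \<iota> \<kappa> x c \<oplus>\<^bsub>tensor_product \<iota> \<kappa>\<^esub> pure_tensor \<iota> \<kappa> y c"
proof -
  interpret ideal "tensor_ideal \<iota> \<kappa>" pair_ring by (rule ideal_tensor_ideal)
  have "pure_tensor \<iota> \<kappa> (x + y) c
      = tensor_ideal \<iota> \<kappa> +>\<^bsub>pair_ring\<^esub> (frag_of (x, c) + frag_of (y, c))"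
    unfolding pure_tensor_def
    by (rule tensor_coset_eq, unfold tensor_relations_def diff_diff_eq[symmetric]) blast
  then show ?thesis
    using a_rcos_sum[of "frag_of (x, c)" "frag_of (y, c)"]
    by (simp add: tensor_product_def pure_tensor_def FactRing_def pair_ring_def)
qed

lemma pure_tensor_add_right:
  "pure_tensor \<iota> \<kappa> x (c + e)
     = pure_tensor \<iota> \<kappa> x c \<oplus>\<^bsub>tensor_product \<iota> \<kappa>\<^esub> pure_tensor \<iota> \<kappa> x e"
proof -
  interpret ideal "tensor_ideal \<iota> \<kappa>" pair_ring by (rule ideal_tensor_ideal)
  have "pure_tensor \<iota> \<kappa> x (c + e)
      = tensor_ideal \<iota> \<kappa> +>\<^bsub>pair_ring\<^esub> (frag_of (x, c) + frag_of (x, e))"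
    unfolding pure_tensor_def
    by (rule tensor_coset_eq, unfold tensor_relations_def diff_diff_eq[symmetric]) blast
  then show ?thesis
    using a_rcos_sum[of "frag_of (x, c)" "frag_of (x, e)"]
    by (simp add: tensor_product_def pure_tensor_def FactRing_def pair_ring_def)
qed

lemma pure_tensor_balanced:
  "pure_tensor \<iota> \<kappa> (\<iota> f * x) c = pure_tensor \<iota> \<kappa> x (\<kappa> f * c)"
  unfolding pure_tensor_def by (rule tensor_coset_eq, unfold tensor_relations_def) blast

text \<open>
  The \<open>'k\<close>-algebra structure of the tensor product is \<open>c \<mapsto> 1 \<otimes> c\<close>, that of the matrix
  algebra is \<open>c \<mapsto> c I\<close>; an isomorphism of \<open>'k\<close>-algebras is a ring isomorphism which is
  compatible with the two.
\<close>

definition splitting_isomorphism ::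
  "('f::field \<Rightarrow> 'd::division_ring) \<Rightarrow> ('f \<Rightarrow> 'k::field) \<Rightarrow> nat \<Rightarrow>
   (('d \<times> 'k \<Rightarrow>\<^sub>0 int) set \<Rightarrow> 'k mat) \<Rightarrow> bool" where
  "splitting_isomorphism \<iota> \<kappa> d h \<longleftrightarrow>
     h \<in> ring_iso (tensor_product \<iota> \<kappa>) (ring_mat TYPE('k) d ()) \<and>
     (\<forall>c. h (pure_tensor \<iota> \<kappa> 1 c) = c \<cdot>\<^sub>m 1\<^sub>m d)"

definition splitting_field ::
  "('f::field \<Rightarrow> 'd::division_ring) \<Rightarrow> ('f \<Rightarrow> 'k::field) \<Rightarrow> nat \<Rightarrow> bool" where
  "splitting_field \<iota> \<kappa> d \<longleftrightarrow>
     field_extension \<kappa> \<and> (\<exists>h. splitting_isomorphism \<iota> \<kappa> d h)"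

definition splitting_representation ::
  "('f::field \<Rightarrow> 'd::division_ring) \<Rightarrow> ('f \<Rightarrow> 'k::field) \<Rightarrow> nat \<Rightarrow> ('d \<Rightarrow> 'k mat) \<Rightarrow> bool" where
  "splitting_representation \<iota> \<kappa> d \<rho> \<longleftrightarrow>
     (\<exists>h. splitting_isomorphism \<iota> \<kappa> d h \<and> (\<forall>x. \<rho> x = h (pure_tensor \<iota> \<kappa> x 1)))"

text \<open>
  The reduced norm of \<open>x\<close> is the determinant of its image under a splitting representation.
\<close>

definition SL1 :: "('d \<Rightarrow> 'k::field mat) \<Rightarrow> 'd set" where
  "SL1 \<rho> = {x. det (\<rho> x) = 1}"

definition GL :: "'k::field itself \<Rightarrow> nat \<Rightarrow> 'k mat set" where
  "GL ty d = Units (ring_mat ty d ())"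

definition conj_mat :: "nat \<Rightarrow> 'k::field mat \<Rightarrow> 'k mat \<Rightarrow> 'k mat" where
  "conj_mat d g B = g * B * inv\<^bsub>ring_mat TYPE('k) d ()\<^esub> g"

text \<open>
  Matrix positions count from \<open>0\<close>, whereas the entries keep their indices \<open>a 1, ..., a d\<close>;
  thus \<open>a (i + 1)\<close> sits in the 0-based position \<open>(i, i + 1)\<close>.
\<close>

definition cyclic_mat :: "nat \<Rightarrow> (nat \<Rightarrow> 'k::field) \<Rightarrow> 'k mat" where
  "cyclic_mat d a = mat d d (\<lambda>(i, j).
     if j = i + 1 then a (i + 1) else if i = d - 1 \<and> j = 0 then a d else 0)"

end

theory Submission
  imports Defs
begin

text \<open>
  Suppose that an element \<open>z\<close> of the division algebra is represented, after conjugation, by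
  the matrix \<open>A\<close> of the statement, and let \<open>p\<close> be the product of the \<open>a\<^sub>i\<close>. The standard
  row vector \<open>e\<^sub>0\<close> is a cyclic vector: \<open>e\<^sub>0 A\<^sup>j\<close> is \<open>a\<^sub>1 \<cdots> a\<^sub>j\<close> times \<open>e\<^sub>j\<close> for \<open>j < d\<close>, and
  \<open>e\<^sub>0 A\<^sup>d\<close> is \<open>p\<close> times \<open>e\<^sub>0\<close>. As \<open>det A = (-1)\<^bsup>d-1\<^esup> p\<close> is the reduced norm \<open>1\<close> of \<open>z\<close>, all
  \<open>a\<^sub>i\<close> are nonzero and \<open>p = (-1)\<^bsup>d-1\<^esup>\<close>. Hence \<open>z\<close> is a root of \<open>X\<^sup>d - (-1)\<^bsup>d-1\<^esup>\<close> and of no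
  nonzero polynomial of smaller degree, so this polynomial would have to be irreducible over
  the centre, because a division algebra has no zero divisors. It is irreducible for no \<open>d\<close>
  with an odd factor \<open>m > 1\<close>: if \<open>d = q m\<close> and \<open>c = (-1)\<^bsup>d-1\<^esup>\<close>, then \<open>c\<^sup>m = c\<close>, so that
  \<open>X\<^sup>q - c\<close> divides \<open>X\<^sup>d - c\<close>.

  The argument is carried out without polynomials, by reading off first rows. The first row of
  the matrix representing an element depends additively on the element and vanishes only at
  \<open>0\<close>, because nonzero elements are units (\<open>eq_zero_if_first_row_zero\<close>). The first rows of the
  powers of \<open>z\<close> therefore determine \<open>z\<^sup>d = c\<close> (\<open>power_eq_sign\<close>), and their supports
  (\<open>first_row_power\<close>) exclude the relations of lower degree that the factorisation of
  \<open>X\<^sup>d - c\<close> forces (\<open>not_cyclic\<close>).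
\<close>

section \<open>Odd factors and geometric sums\<close>

lemma odd_factor_if_not_power_of_two:
  fixes d :: nat
  assumes "d > 0" "\<not> (\<exists>n. d = 2 ^ n)"
  obtains k m where "d = 2 ^ k * m" "odd m" "m > 1"
proof -
  obtain m where m: "d = 2 ^ multiplicity 2 d * m" "\<not> 2 dvd m"
    using multiplicity_decompose'[of d 2] assms(1) by auto
  have "m \<noteq> 1" using m(1) assms(2) by auto
  with m have "m > 1" by (cases m) auto
  with m that show thesis by blast
qed

lemma diff_one_times_geometric_sum:
  fixes v :: "'a::ring_1"
  shows "(v - 1) * (\<Sum>i<m. v ^ i) = v ^ m - 1"
  by (induction m) (simp_all add: algebra_simps)

section \<open>The cyclic matrix\<close>

lemma cyclic_mat_carrier [simp]: "cyclic_mat d a \<in> carrier_mat d d"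
  by (simp add: cyclic_mat_def)

lemma cyclic_mat_index:
  assumes "i < d" "j < d"
  shows "cyclic_mat d a $$ (i, j) =
    (if j = i + 1 then a (i + 1) else if i = d - 1 \<and> j = 0 then a d else 0)"
  using assms by (simp add: cyclic_mat_def)

text \<open>
  Expand along the first column, whose only entry is the corner \<open>a d\<close>; the complementary
  minor is diagonal.
\<close>

lemma det_cyclic_mat:
  assumes "d > 1"
  shows "det (cyclic_mat d a) = (-1) ^ (d - 1) * (\<Prod>l=1..d. a l)"
proof -
  let ?A = "cyclic_mat d a"
  obtain e where e: "d = Suc e" using assms by (cases d) auto
  let ?M = "mat_delete ?A e 0"
  have M: "?M \<in> carrier_mat e e"
    using mat_delete_carrier[OF cyclic_mat_carrier[of d a]] e by simp
  have M_index: "?M $$ (i, j) = (if i = j then a (Suc i) else 0)" if "i < e" "j < e" for i j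
    using that e by (auto simp: mat_delete_def cyclic_mat_def)
  have "det ?M = prod_list (diag_mat ?M)"
    by (rule det_upper_triangular[OF _ M])
      (use M M_index in \<open>auto simp: upper_triangular_def\<close>)
  also have "\<dots> = (\<Prod>i=0..<e. a (Suc i))"
    unfolding prod_list_diag_prod using M M_index by (auto intro!: prod.cong)
  also have "\<dots> = (\<Prod>l=1..e. a l)"
    by (simp add: prod.shift_bounds_Suc_ivl[symmetric] atLeastLessThanSuc_atLeastAtMost)
  finally have det_M: "det ?M = (\<Prod>l=1..e. a l)" .
  have "det ?A = (\<Sum>i<d. ?A $$ (i, 0) * cofactor ?A i 0)"
    using assms by (intro laplace_expansion_column) auto
  also have "\<dots> = (\<Sum>i<e. ?A $$ (i, 0) * cofactor ?A i 0) + ?A $$ (e, 0) * cofactor ?A e 0"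
    by (simp add: e)
  also have "(\<Sum>i<e. ?A $$ (i, 0) * cofactor ?A i 0) = 0"
    by (rule sum.neutral) (auto simp: e cyclic_mat_index)
  also have "?A $$ (e, 0) = a d"
    by (simp add: e cyclic_mat_index)
  finally show ?thesis
    by (simp add: cofactor_def det_M) (simp add: e)
qed

section \<open>Matrix representations of a division ring\<close>

locale matrix_representation =
  fixes n :: nat and \<phi> :: "'d::division_ring \<Rightarrow> 'k::field mat"
  assumes size_pos: "n > 0"
    and carrier: "\<phi> x \<in> carrier_mat n n"
    and add: "\<phi> (x + y) = \<phi> x + \<phi> y"
    and mult: "\<phi> (x * y) = \<phi> x * \<phi> y"
    and one: "\<phi> 1 = 1\<^sub>m n"
begin

lemma dim [simp]: "dim_row (\<phi> x) = n" "dim_col (\<phi> x) = n"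
  using carrier[of x] by auto

definition first_row :: "'d \<Rightarrow> nat \<Rightarrow> 'k" where
  "first_row x j = \<phi> x $$ (0, j)"

lemma first_row_add: "j < n \<Longrightarrow> first_row (x + y) j = first_row x j + first_row y j"
  using size_pos by (simp add: first_row_def add)

lemma first_row_zero: "j < n \<Longrightarrow> first_row 0 j = 0"
  using first_row_add[of j 0 0] by (metis add.right_neutral add_left_imp_eq)

lemma first_row_minus: "j < n \<Longrightarrow> first_row (- x) j = - first_row x j"
  using first_row_add[of j x "- x"] first_row_zero by (simp add: eq_neg_iff_add_eq_0 add.commute)

lemma first_row_diff: "j < n \<Longrightarrow> first_row (x - y) j = first_row x j - first_row y j"
  using first_row_add[of j x "- y"] first_row_minus by simp

lemma first_row_sum:
  "j < n \<Longrightarrow> first_row (\<Sum>i\<in>I. f i) j = (\<Sum>i\<in>I. first_row (f i) j)"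
  by (induction I rule: infinite_finite_induct) (simp_all add: first_row_zero first_row_add)

lemma first_row_sign: "j < n \<Longrightarrow> first_row ((-1) ^ s * x) j = (-1) ^ s * first_row x j"
  by (induction s) (simp_all add: first_row_minus)

lemma first_row_one: "j < n \<Longrightarrow> first_row 1 j = (if j = 0 then 1 else 0)"
  using size_pos by (auto simp: first_row_def one)

lemma first_row_mult:
  assumes "j < n"
  shows "first_row (x * y) j = (\<Sum>i<n. first_row x i * \<phi> y $$ (i, j))"
  using assms size_pos
  by (simp add: first_row_def mult scalar_prod_def atLeast0LessThan)

text \<open>
  A nonzero \<open>x\<close> is a unit, and a matrix with vanishing first row is not invertible.
\<close>

lemma eq_zero_if_first_row_zero:
  assumes "\<And>j. j < n \<Longrightarrow> first_row x j = 0"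
  shows "x = 0"
proof (rule ccontr)
  assume "x \<noteq> 0"
  then have "first_row 1 0 = first_row (x * inverse x) 0" by simp
  also have "\<dots> = 0" unfolding first_row_mult[OF size_pos] using assms by simp
  finally show False using first_row_one size_pos by simp
qed

lemma eq_if_first_row_eq:
  assumes "\<And>j. j < n \<Longrightarrow> first_row x j = first_row y j"
  shows "x = y"
  using eq_zero_if_first_row_zero[of "x - y"] assms by (simp add: first_row_diff)

end

section \<open>Elements represented by a cyclic matrix\<close>

locale cyclic_element = matrix_representation +
  fixes z and a
  assumes cyclic: "\<phi> z = cyclic_mat n a"
begin

lemma first_row_times_z:
  assumes "l < n"
    and x: "\<And>i. i < n \<Longrightarrow> first_row x i = (if i = j then c else 0)" and "j < n"
  shows "first_row (x * z) l = c * cyclic_mat n a $$ (j, l)"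
proof -
  have "first_row (x * z) l = (\<Sum>i<n. if i = j then c * cyclic_mat n a $$ (j, l) else 0)"
    unfolding first_row_mult[OF assms(1)] by (intro sum.cong) (auto simp: x cyclic)
  then show ?thesis using \<open>j < n\<close> by simp
qed

text \<open>
  The matrix of \<open>z\<close> maps the row vector \<open>e\<^sub>j\<close> to a multiple of \<open>e\<^sub>j\<^sub>+\<^sub>1\<close>, until after \<open>n\<close> steps
  the corner entry returns to \<open>e\<^sub>0\<close>.
\<close>

lemma first_row_power:
  assumes "j < n" "l < n"
  shows "first_row (z ^ j) l = (if l = j then \<Prod>i=1..j. a i else 0)"
  using assms
proof (induction j arbitrary: l)
  case 0
  then show ?case by (simp add: first_row_one)
next
  case (Suc j)
  have "first_row (z ^ Suc j) l = (\<Prod>i=1..j. a i) * cyclic_mat n a $$ (j, l)"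
    unfolding power_Suc2 using Suc by (intro first_row_times_z) auto
  moreover have "j \<noteq> n - 1" using Suc.prems by simp
  ultimately show ?case using Suc.prems by (simp add: cyclic_mat_index)
qed

lemma first_row_power_size:
  assumes "l < n"
  shows "first_row (z ^ n) l = (if l = 0 then \<Prod>i=1..n. a i else 0)"
proof -
  obtain e where e: "n = Suc e" using size_pos by (cases n) auto
  have "first_row (z ^ n) l = (\<Prod>i=1..e. a i) * cyclic_mat n a $$ (e, l)"
    unfolding e power_Suc2 using e assms first_row_power[of e]
    by (intro first_row_times_z[unfolded e]) auto
  then show ?thesis using assms by (simp add: cyclic_mat_index e)
qed

text \<open>
  The determinant \<open>1\<close> fixes the product of the \<open>a\<^sub>i\<close>. The two elements are then equal because their
  first rows are.
\<close>

lemma power_eq_sign: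
  assumes "n > 1" "det (\<phi> z) = 1"
  shows "z ^ n = (-1) ^ (n - 1)"
proof (rule eq_if_first_row_eq)
  fix l assume l: "l < n"
  have "(-1) ^ (n - 1) * (\<Prod>i=1..n. a i) = 1"
    using assms det_cyclic_mat[of n a] by (simp add: cyclic)
  then have "(-1) ^ (n - 1) * ((-1) ^ (n - 1) * (\<Prod>i=1..n. a i)) = (-1) ^ (n - 1)"
    by simp
  then have "(\<Prod>i=1..n. a i) = (-1) ^ (n - 1)"
    by (simp add: mult.assoc[symmetric] power_mult_distrib[symmetric])
  then show "first_row (z ^ n) l = first_row ((-1) ^ (n - 1)) l"
    using l first_row_sign[of l "n - 1" 1] by (simp add: first_row_power_size first_row_one)
qed

text \<open>
  For \<open>n = q m\<close> with \<open>m\<close> odd and \<open>c = (-1)\<^bsup>n-1\<^esup>\<close>, the element \<open>v = c z\<^sup>q\<close> satisfies \<open>v\<^sup>m = 1\<close>, so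
  that \<open>v = 1\<close> or \<open>1 + v + \<cdots> + v\<^bsup>m-1\<^esup> = 0\<close>. Either one is a relation between powers of \<open>z\<close> with
  exponents below \<open>n\<close>.
\<close>

lemma not_cyclic:
  assumes "n > 1" "det (\<phi> z) = 1" "\<not> (\<exists>k. n = 2 ^ k)"
  shows False
proof -
  obtain k m where n: "n = 2 ^ k * m" and m: "odd m" "m > 1"
    using odd_factor_if_not_power_of_two[of n] assms by auto
  define q :: nat where "q = 2 ^ k"
  have q: "n = q * m" "q > 0" by (simp_all add: q_def n)
  define s where "s = n - 1"
  define v where "v = (-1) ^ s * z ^ q"
  have v_power: "v ^ i = (-1) ^ (s * i) * z ^ (q * i)" for i
    by (cases "even s") (auto simp: v_def power_mult power_minus[of "z ^ q"])
  have v_row: "first_row (v ^ i) l = (if l = q * i then (-1) ^ (s * i) * (\<Prod>t=1..l. a t) else 0)"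
    if "i < m" "l < n" for i l
  proof -
    have "q * i < n" using that q by simp
    then show ?thesis using that(2) by (simp add: v_power first_row_sign first_row_power)
  qed
  have "(\<Prod>i=1..n. a i) \<noteq> 0"
  proof
    assume "(\<Prod>i=1..n. a i) = 0"
    then have "det (\<phi> z) = 0"
      by (simp only: cyclic det_cyclic_mat[OF assms(1)] mult_zero_right)
    with assms(2) show False by simp
  qed
  then have a_nonzero: "(\<Prod>t=1..l. a t) \<noteq> 0" if "l < n" for l
    using that by (auto simp: Ball_def)
  have "v ^ m = (-1) ^ (s * m) * (-1) ^ s"
    using power_eq_sign[OF assms(1,2)] by (simp only: v_power q(1)[symmetric] s_def)
  also have "\<dots> = (-1) ^ (s * Suc m)"
    by (simp only: power_add[symmetric] mult_Suc_right add.commute)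
  also have "\<dots> = 1" using m by simp
  finally have "(v - 1) * (\<Sum>i<m. v ^ i) = 0"
    by (simp add: diff_one_times_geometric_sum)
  then consider "v = 1" | "(\<Sum>i<m. v ^ i) = 0" by auto
  then show False
  proof cases
    case 1
    have "q < n" using q m by simp
    then show False
      using v_row[of 1 q] a_nonzero[of q] first_row_one[of q] m q by (simp add: 1)
  next
    case 2
    \<comment> \<open>The supports \<open>{q i}\<close> of the first rows of the \<open>v\<^sup>i\<close> are distinct, so the last one survives.\<close>
    obtain e where e: "m = Suc e" using m by (cases m) auto
    have l: "q * e < n" using q e by simp
    have "first_row (\<Sum>i<m. v ^ i) (q * e)
        = (\<Sum>i<e. first_row (v ^ i) (q * e)) + first_row (v ^ e) (q * e)"
      using l by (simp add: e first_row_add first_row_sum)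
    also have "(\<Sum>i<e. first_row (v ^ i) (q * e)) = 0"
      using l q e by (intro sum.neutral) (auto simp: v_row)
    finally have "first_row (v ^ e) (q * e) = 0"
      unfolding 2 using l first_row_zero by simp
    then show False
      using v_row[of e "q * e"] l a_nonzero[OF l] e by simp
  qed
qed

end

section \<open>Splitting representations\<close>

lemma pure_tensor_carrier: "pure_tensor \<iota> \<kappa> x c \<in> carrier (tensor_product \<iota> \<kappa>)"
  by (auto simp: tensor_product_def pure_tensor_def FactRing_def A_RCOSETS_def' pair_ring_def)

lemma matrix_representation_splitting:
  assumes "splitting_representation \<iota> \<kappa> d \<rho>" "d > 0"
  shows "matrix_representation d \<rho>"
proof -
  obtain h where h: "h \<in> ring_iso (tensor_product \<iota> \<kappa>) (ring_mat TYPE('c) d ())"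
    and \<rho>: "\<And>x. \<rho> x = h (pure_tensor \<iota> \<kappa> x 1)"
    using assms(1) unfolding splitting_representation_def splitting_isomorphism_def by blast
  have hom: "h \<in> Ring.ring_hom (tensor_product \<iota> \<kappa>) (ring_mat TYPE('c) d ())"
    using h by (simp add: ring_iso_def)
  show ?thesis
  proof
    show "\<rho> x \<in> carrier_mat d d" for x
      using ring_hom_closed[OF hom pure_tensor_carrier] by (simp add: \<rho> ring_mat_simps)
    show "\<rho> (x + y) = \<rho> x + \<rho> y" for x y
      using ring_hom_add[OF hom pure_tensor_carrier pure_tensor_carrier]
      by (simp add: \<rho> ring_mat_simps pure_tensor_add_left)
    show "\<rho> (x * y) = \<rho> x * \<rho> y" for x y
      using ring_hom_mult[OF hom pure_tensor_carrier pure_tensor_carrier, of x 1 y 1]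
      by (simp add: \<rho> ring_mat_simps pure_tensor_mult)
    show "\<rho> 1 = 1\<^sub>m d"
      using ring_hom_one[OF hom] by (simp add: \<rho> ring_mat_simps one_tensor_product)
  qed (rule assms(2))
qed

lemma GL_inverse:
  assumes "g \<in> GL TYPE('k::field) d"
  defines "g' \<equiv> inv\<^bsub>ring_mat TYPE('k) d ()\<^esub> g"
  shows "g \<in> carrier_mat d d" "g' \<in> carrier_mat d d" "g * g' = 1\<^sub>m d" "g' * g = 1\<^sub>m d"
proof -
  interpret R: ring "ring_mat TYPE('k) d ()" by (rule ring_mat)
  have g: "g \<in> Units (ring_mat TYPE('k) d ())" using assms by (simp add: GL_def)
  show "g \<in> carrier_mat d d" "g' \<in> carrier_mat d d" "g * g' = 1\<^sub>m d" "g' * g = 1\<^sub>m d"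
    using R.Units_closed[OF g] R.Units_inv_closed[OF g] R.Units_r_inv[OF g] R.Units_l_inv[OF g]
    by (simp_all add: g'_def ring_mat_simps)
qed

lemma similar_conj_mat:
  assumes "g \<in> GL TYPE('k::field) d" "B \<in> carrier_mat d d"
  shows "similar_mat (conj_mat d g B) B"
  using GL_inverse[OF assms(1)] assms(2)
  by (intro similar_matI[of _ _ g "inv\<^bsub>ring_mat TYPE('k) d ()\<^esub> g" d]) (auto simp: conj_mat_def)

lemma matrix_representation_conj:
  fixes \<phi> :: "'d::division_ring \<Rightarrow> 'k::field mat"
  assumes "matrix_representation d \<phi>" and g: "g \<in> GL TYPE('k) d"
  shows "matrix_representation d (\<lambda>x. conj_mat d g (\<phi> x))"
proof -
  interpret matrix_representation d \<phi> by fact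
  define g' where "g' = inv\<^bsub>ring_mat TYPE('k) d ()\<^esub> g"
  note G = GL_inverse[OF g, folded g'_def]
  note C = G(1,2) carrier
  note assoc = assoc_mult_mat[where n\<^sub>1 = d and n\<^sub>2 = d and n\<^sub>3 = d and n\<^sub>4 = d]
  note closed = mult_carrier_mat[where nr = d and n = d and nc = d]
  show ?thesis
    unfolding conj_mat_def g'_def[symmetric]
  proof
    show "g * \<phi> x * g' \<in> carrier_mat d d" for x
      using C by auto
    show "g * \<phi> (x + y) * g' = g * \<phi> x * g' + g * \<phi> y * g'" for x y
      unfolding add
      using C
      by (simp add: mult_add_distrib_mat[where nr = d and n = d and nc = d]
          add_mult_distrib_mat[where nr = d and n = d and nc = d])
    show "g * \<phi> (x * y) * g' = g * \<phi> x * g' * (g * \<phi> y * g')" for x y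
    proof -
      have "g * \<phi> x * g' * (g * \<phi> y * g') = g * \<phi> x * (g' * (g * (\<phi> y * g')))"
        using C by (simp add: assoc closed)
      also have "g' * (g * (\<phi> y * g')) = g' * g * (\<phi> y * g')"
        using C by (simp add: assoc closed)
      also have "\<dots> = \<phi> y * g'"
        using C by (simp add: G(4) left_mult_one_mat closed)
      finally show ?thesis
        using C by (simp add: mult assoc closed)
    qed
    show "g * \<phi> 1 * g' = 1\<^sub>m d"
      using C G(3) by (simp add: one)
  qed (rule size_pos)
qed

theorem theorem3p12:
  fixes \<iota> :: "'f::field \<Rightarrow> 'd::division_ring"
    and \<kappa> :: "'f \<Rightarrow> 'k::field"
    and \<rho> :: "'d \<Rightarrow> 'k mat"
    and d :: nat
  assumes "central_division_algebra \<iota>"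
    and "has_degree \<iota> d"
    and "d > 2"
    and "splitting_field \<iota> \<kappa> d"
    and "splitting_representation \<iota> \<kappa> d \<rho>"
    and "\<not> (\<exists>n::nat. d = 2 ^ n)"
  shows "\<forall>z \<in> SL1 \<rho>. \<forall>g \<in> GL TYPE('k) d. \<not> (\<exists>a :: nat \<Rightarrow> 'k. conj_mat d g (\<rho> z) = cyclic_mat d a)"
proof (intro ballI notI, elim exE)
  fix z g and a :: "nat \<Rightarrow> 'k"
  assume z: "z \<in> SL1 \<rho>" and g: "g \<in> GL TYPE('k) d"
    and cyclic: "conj_mat d g (\<rho> z) = cyclic_mat d a"
  interpret matrix_representation d \<rho>
    using matrix_representation_splitting assms(3,5) by force
  interpret conj: matrix_representation d "\<lambda>x. conj_mat d g (\<rho> x)"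
    by (rule matrix_representation_conj[OF matrix_representation_axioms g])
  interpret cyclic_element d "\<lambda>x. conj_mat d g (\<rho> x)" z a
    by unfold_locales (rule cyclic)
  have "det (conj_mat d g (\<rho> z)) = 1"
    using det_similar[OF similar_conj_mat[OF g carrier]] z by (simp add: SL1_def)
  then show False
    using not_cyclic assms(3,6) by force
qed

end
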